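(* Let $n\ge2$. For a permutation $\tau\in\mathfrak S_n$ with $\tau\neq\mathrm{id}$, let $j+1$ be the smallest element of $\{1,\dots,n\}$ not fixed by $\tau$, and let $i$ be defined by $\tau_i=j+1$ (so $i>j+1$). Define $\mathbf f_\tau:\mathfrak S_n\to\mathbb R$ by $\mathbf f_\tau(\sigma)=1$ if $(\sigma_{j+1}\sigma_{j+2}\cdots\sigma_n)$ is in the same relative order as $(\tau_{j+1}\tau_{j+2}\cdots\tau_n)$; $\mathbf f_\tau(\sigma)=-1$ if $(\sigma_{j+1}\cdots\sigma_n)$ is in the same relative order as $((j+1)\tau_{j+1}\cdots\tau_{i-1}\tau_{i+1}\cdots\tau_n)$; and $\mathbf f_\tau(\sigma)=0$ otherwise. Set $\mathbf f_{\mathrm{id}}\equiv1$ (with $j=n$). Then each $\mathbf f_\tau$ is a right eigenfunction of the top-to-random-with-standardisation chain with eigenvalue $\beta_j=\frac jn$, and of the binomial-top-to-random-with-standardisation chain with parameter $q_2$ with eigenvalue $\beta_j=q_2^{n-j}$, and $\{\mathbf f_\tau:\tau\in\mathfrak S_n\}$ is a basis of the space of functions $\mathfrak S_n\to\mathbb R$.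
   Context: Permutations are written in one-line notation $\sigma=(\sigma_1\cdots\sigma_n)$. Two strings of distinct numbers of the same length are in the same relative order if their standardisations coincide, where the standardisation of a string of distinct numbers replaces its letters by $1,2,\dots$ preserving relative order. Top-to-random-with-standardisation chain on $\mathfrak S_n$: from $\sigma$, remove the first letter $\sigma_1$, replace the remaining letters by $2,\dots,n$ preserving their relative order, then insert the letter $1$ into one of the $n$ positions chosen uniformly. Binomial-top-to-random-with-standardisation chain with parameter $q_2\in[0,1]$: choose $r\sim\mathrm{Binomial}(n,1-q_2)$, remove the first $r$ letters, replace the remaining letters by $r+1,\dots,n$ preserving their relative order, then insert the letters $1,\dots,r$ so that the result is uniformly distributed among the $n!/(n-r)!$ permutations of $\mathfrak S_n$ in which the letters $r+1,\dots,n$ appear in that relative order. A right eigenfunction with eigenvalue $\beta$ of a chain with transition matrix $K$ is $\mathbf f$ with $\sum_yK(x,y)\mathbf f(y)=\beta\mathbf f(x)$. *)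

theory Defs
  imports
    "HOL-Combinatorics.Multiset_Permutations"
    "HOL-Library.Function_Algebras"
    "HOL-Probability.Probability_Mass_Function"
begin

text \<open>Permutations of \<open>{1..n}\<close> are lists in one-line notation. Letters are numbered from 1, so
  the letter \<open>\<sigma>\<^sub>k\<close> is \<open>\<sigma> ! (k - 1)\<close>, and \<open>drop j \<sigma>\<close> is the string \<open>\<sigma>\<^sub>j\<^sub>+\<^sub>1 \<dots> \<sigma>\<^sub>n\<close>.\<close>

abbreviation perms :: "nat \<Rightarrow> nat list set" where
  "perms n \<equiv> permutations_of_set {1..n}"

definition id_perm :: "nat \<Rightarrow> nat list" where
  "id_perm n = [1..<Suc n]"

definition letter :: "nat list \<Rightarrow> nat \<Rightarrow> nat" where
  "letter \<sigma> k = \<sigma> ! (k - 1)"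

definition standardise :: "nat list \<Rightarrow> nat list" where
  "standardise xs = map (\<lambda>x. card {y \<in> set xs. y \<le> x}) xs"

definition same_relative_order :: "nat list \<Rightarrow> nat list \<Rightarrow> bool" where
  "same_relative_order xs ys \<longleftrightarrow> standardise xs = standardise ys"

definition remove_top :: "nat \<Rightarrow> nat list \<Rightarrow> nat list" where
  "remove_top r \<sigma> = map ((+) r) (standardise (drop r \<sigma>))"

definition insert_at :: "nat \<Rightarrow> nat \<Rightarrow> nat list \<Rightarrow> nat list" where
  "insert_at p a xs = take p xs @ a # drop p xs"

definition top_to_random_std :: "nat \<Rightarrow> nat list \<Rightarrow> nat list pmf" where
  "top_to_random_std n \<sigma> = map_pmf (\<lambda>p. insert_at p 1 (remove_top 1 \<sigma>)) (pmf_of_set {..<n})"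

definition binomial_top_to_random_std :: "nat \<Rightarrow> real \<Rightarrow> nat list \<Rightarrow> nat list pmf" where
  "binomial_top_to_random_std n q \<sigma> =
     bind_pmf (binomial_pmf n (1 - q))
       (\<lambda>r. pmf_of_set {\<rho> \<in> perms n. filter (\<lambda>a. r < a) \<rho> = remove_top r \<sigma>})"

definition transition_matrix :: "('a \<Rightarrow> 'a pmf) \<Rightarrow> 'a \<Rightarrow> 'a \<Rightarrow> real" where
  "transition_matrix step x y = pmf (step x) y"

definition right_eigenfunction ::
    "'a set \<Rightarrow> ('a \<Rightarrow> 'a \<Rightarrow> real) \<Rightarrow> real \<Rightarrow> ('a \<Rightarrow> real) \<Rightarrow> bool" where
  "right_eigenfunction S K \<beta> f \<longleftrightarrow> (\<forall>x\<in>S. (\<Sum>y\<in>S. K x y * f y) = \<beta> * f x)"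

definition fixed_prefix :: "nat \<Rightarrow> nat list \<Rightarrow> nat" where
  "fixed_prefix n \<tau> =
     (if \<tau> = id_perm n then n
      else (LEAST k. k \<in> {1..n} \<and> letter \<tau> k \<noteq> k) - 1)"

definition position :: "nat \<Rightarrow> nat list \<Rightarrow> nat \<Rightarrow> nat" where
  "position n \<tau> a = (THE i. i \<in> {1..n} \<and> letter \<tau> i = a)"

text \<open>The string \<open>drop j (take (i - 1) \<tau>)\<close> is \<open>\<tau>\<^sub>j\<^sub>+\<^sub>1 \<dots> \<tau>\<^sub>i\<^sub>-\<^sub>1\<close>. A function on \<open>perms n\<close> is
  represented by its extension by 0 to all lists.\<close>

definition eigfun :: "nat \<Rightarrow> nat list \<Rightarrow> nat list \<Rightarrow> real" where
  "eigfun n \<tau> \<sigma> =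
     (if \<sigma> \<notin> perms n then 0
      else if \<tau> = id_perm n then 1
      else
        let j = fixed_prefix n \<tau>; i = position n \<tau> (j + 1) in
          if same_relative_order (drop j \<sigma>) (drop j \<tau>) then 1
          else if same_relative_order (drop j \<sigma>)
                    ((j + 1) # drop j (take (i - 1) \<tau>) @ drop i \<tau>) then - 1
          else 0)"

definition fscale :: "real \<Rightarrow> ('a \<Rightarrow> real) \<Rightarrow> 'a \<Rightarrow> real" where
  "fscale c f = (\<lambda>x. c * f x)"

interpretation funs: vector_space "fscale :: real \<Rightarrow> ('a \<Rightarrow> real) \<Rightarrow> 'a \<Rightarrow> real"
  by unfold_locales (auto simp: fscale_def fun_eq_iff algebra_simps)

definition functions_on :: "'a set \<Rightarrow> ('a \<Rightarrow> real) set" where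
  "functions_on S = {f. \<forall>x. x \<notin> S \<longrightarrow> f x = 0}"

definition is_basis :: "('a \<Rightarrow> real) set \<Rightarrow> ('a \<Rightarrow> real) set \<Rightarrow> bool" where
  "is_basis B V \<longleftrightarrow> funs.independent B \<and> funs.span B = V"

end

theory Submission
  imports Defs
begin

text \<open>Write \<open>m = n - j\<close>. The function \<open>f\<^sub>\<tau>\<close> depends only on the relative order of the last \<open>m\<close> letters
  and is a difference of two indicators of patterns that agree after deletion of their smallest
  letter. Insert a new smallest letter at every position of a word \<open>w\<close>: positions in front of the
  last \<open>m\<close> letters do not change the value, and over the remaining \<open>m\<close> positions the two indicators
  cancel. So the sum over all insertions is \<open>length w + 1 - m\<close> times the value at \<open>w\<close>. One insertion
  gives the eigenvalue \<open>j / n\<close>; inserting \<open>r, r - 1, \<dots>, 1\<close> in turn gives the falling factorial of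
  \<open>j\<close> of order \<open>r\<close>, and the binomial average is evaluated by the binomial theorem.

  Eigenfunctions for distinct eigenvalues \<open>j / n\<close> are independent, and among the \<open>\<tau>\<close> with a common
  \<open>j\<close> the matrix of values \<open>f\<^sub>\<tau>(\<sigma>)\<close> is the identity, since no such \<open>\<sigma>\<close> has the letter
  \<open>j + 1\<close> in position \<open>j + 1\<close>. A dimension count then gives a basis.\<close>

section \<open>Inserting a letter into a word\<close>

lemma insert_at_length_append [simp]: "insert_at (length us) a (us @ vs) = us @ a # vs"
  by (simp add: insert_at_def)

lemma length_insert_at [simp]: "length (insert_at p a xs) = Suc (length xs)"
  by (simp add: insert_at_def)

lemma set_insert_at [simp]: "set (insert_at p a xs) = insert a (set xs)"
proof -
  have "set (take p xs) \<union> set (drop p xs) = set xs"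
    by (metis append_take_drop_id set_append)
  then show ?thesis by (auto simp: insert_at_def)
qed

lemma distinct_insert_at [simp]: "distinct (insert_at p a xs) \<longleftrightarrow> a \<notin> set xs \<and> distinct xs"
proof -
  have "distinct (insert_at p a xs) \<longleftrightarrow> distinct (a # take p xs @ drop p xs)"
    unfolding insert_at_def distinct_append distinct.simps set_append by auto
  then show ?thesis by simp
qed

text \<open>The single occurrence of \<open>a\<close> marks where the word was cut. The length
  bounds exclude positions past the end, where \<open>take\<close> truncates and different
  \<open>p\<close> give the same word.\<close>

lemma insert_at_inject:
  assumes "a \<notin> set xs" "a \<notin> set ys" "p \<le> length xs" "q \<le> length ys"
  shows "insert_at p a xs = insert_at q a ys \<longleftrightarrow> p = q \<and> xs = ys"
proof
  assume "insert_at p a xs = insert_at q a ys"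
  moreover have "a \<notin> set (take p xs)" "a \<notin> set (take q ys)" "a \<notin> set (drop p xs)"
    using assms by (auto dest: in_set_takeD in_set_dropD)
  ultimately have *: "take p xs = take q ys" "drop p xs = drop q ys"
    by (auto simp: insert_at_def append_Cons_eq_iff)
  have "p = q"
    using arg_cong[OF *(1), of length] assms by simp
  with * show "p = q \<and> xs = ys"
    by (metis append_take_drop_id)
qed simp

lemma filter_insert_at:
  "filter P (insert_at p a xs) =
     (if P a then filter P (take p xs) @ a # filter P (drop p xs) else filter P xs)"
proof -
  have "filter P (take p xs) @ filter P (drop p xs) = filter P xs"
    by (metis append_take_drop_id filter_append)
  then show ?thesis by (simp add: insert_at_def)
qed

section \<open>Standardisation and relative order\<close>

text \<open>A strictly increasing relabelling maps the letters up to \<open>x\<close> onto the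
  letters up to \<open>f x\<close>, so all ranks stay the same.\<close>

lemma standardise_map_strict_mono_on:
  assumes "strict_mono_on (set xs) f"
  shows "standardise (map f xs) = standardise xs"
proof -
  have "card {y \<in> f ` set xs. y \<le> f x} = card {y \<in> set xs. y \<le> x}" if "x \<in> set xs" for x
  proof -
    have "{y \<in> f ` set xs. y \<le> f x} = f ` {y \<in> set xs. y \<le> x}"
      using strict_mono_on_leD[OF assms] strict_mono_onD[OF assms] that
      by (force simp: not_less[symmetric])
    moreover have "inj_on f {y \<in> set xs. y \<le> x}"
      using strict_mono_on_imp_inj_on[OF assms] by (rule inj_on_subset) auto
    ultimately show ?thesis by (simp add: card_image)
  qed
  then show ?thesis by (simp add: standardise_def)
qed

lemma rank_strict_mono_on:
  fixes A :: "'a::linorder set"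
  assumes "finite A"
  shows "strict_mono_on A (\<lambda>x. card {y \<in> A. y \<le> x})"
proof (rule strict_mono_onI)
  fix r s assume "r \<in> A" "s \<in> A" "r < s"
  then have "{y \<in> A. y \<le> r} \<subset> {y \<in> A. y \<le> s}" by force
  then show "card {y \<in> A. y \<le> r} < card {y \<in> A. y \<le> s}"
    using assms by (intro psubset_card_mono) auto
qed

lemma length_standardise [simp]: "length (standardise xs) = length xs"
  by (simp add: standardise_def)

text \<open>On a common alphabet the rank map is injective. This turns equality of relative order
  into equality of words when two suffixes use the same letters.\<close>

lemma standardise_eq_iff_of_set_eq:
  assumes "set xs = set ys"
  shows "standardise xs = standardise ys \<longleftrightarrow> xs = ys"
proof -
  have "inj_on (\<lambda>x. card {y \<in> set ys. y \<le> x}) (set ys)"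
    by (intro strict_mono_on_imp_inj_on rank_strict_mono_on) simp
  then show ?thesis
    by (simp add: standardise_def assms inj_on_map_eq_map)
qed

text \<open>The relabelling done by \<open>remove_top\<close> is rank plus \<open>r\<close>, which
  is strictly increasing on the remaining letters, so every later suffix keeps its pattern.\<close>

lemma standardise_drop_remove_top:
  "standardise (drop k (remove_top r \<sigma>)) = standardise (drop (k + r) \<sigma>)"
proof -
  have "strict_mono_on (set (drop k (drop r \<sigma>)))
          ((+) r \<circ> (\<lambda>x. card {y \<in> set (drop r \<sigma>). y \<le> x}))"
    using strict_mono_onD[OF rank_strict_mono_on[OF finite_set[of "drop r \<sigma>"]]]
    by (intro strict_mono_onI) (simp only: o_apply nat_add_left_cancel_less in_set_dropD)
  then show ?thesis
    by (simp add: remove_top_def standardise_def[of "drop r \<sigma>"] drop_map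
        standardise_map_strict_mono_on)
qed

text \<open>The new letter is the smallest, so it gets rank 1 and raises every other rank by
  one.\<close>

lemma standardise_insert_at:
  assumes "distinct xs" "\<And>x. x \<in> set xs \<Longrightarrow> a < x"
  shows "standardise (insert_at p a xs) = insert_at p 1 (map Suc (standardise xs))"
proof -
  define g where "g x = card {y \<in> insert a (set xs). y \<le> x}" for x
  have "{y \<in> insert a (set xs). y \<le> a} = {a}" using assms(2) by force
  then have a: "g a = 1" by (simp add: g_def)
  have g: "g x = Suc (card {y \<in> set xs. y \<le> x})" if "x \<in> set xs" for x
  proof -
    have "{y \<in> insert a (set xs). y \<le> x} = insert a {y \<in> set xs. y \<le> x}"
      using assms(2)[OF that] by auto
    moreover have "a \<notin> {y \<in> set xs. y \<le> x}" using assms(2) by auto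
    ultimately show ?thesis by (simp add: g_def)
  qed
  have "standardise (insert_at p a xs) = map g (insert_at p a xs)"
    by (simp add: standardise_def g_def)
  also have "\<dots> = insert_at p 1 (map g xs)"
    by (simp add: insert_at_def a take_map drop_map)
  also have "map g xs = map Suc (standardise xs)"
    by (simp add: standardise_def g)
  finally show ?thesis .
qed

text \<open>The ranks lie in the interval and are pairwise distinct, so by counting they fill
  it.\<close>

lemma set_standardise:
  assumes "distinct xs"
  shows "set (standardise xs) = {1..length xs}"
proof -
  let ?g = "\<lambda>x. card {y \<in> set xs. y \<le> x}"
  have "?g ` set xs \<subseteq> {1..length xs}"
  proof clarsimp
    fix x assume "x \<in> set xs"
    then have "{y \<in> set xs. y \<le> x} \<noteq> {}" by auto
    moreover have "card {y \<in> set xs. y \<le> x} \<le> card (set xs)" by (intro card_mono) auto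
    ultimately show "Suc 0 \<le> ?g x \<and> ?g x \<le> length xs"
      using distinct_card[OF assms] by (simp add: Suc_le_eq card_gt_0_iff)
  qed
  moreover have "card (?g ` set xs) = length xs"
    using card_image[OF strict_mono_on_imp_inj_on[OF rank_strict_mono_on[of "set xs"]]]
      distinct_card[OF assms] by simp
  ultimately have "?g ` set xs = {1..length xs}"
    by (intro card_subset_eq) auto
  then show ?thesis by (simp add: standardise_def)
qed

lemma distinct_standardise:
  assumes "distinct xs"
  shows "distinct (standardise xs)"
  using set_standardise[OF assms] by (metis card_atLeastAtMost card_distinct diff_Suc_1 length_standardise)

section \<open>Permutations and removal of the first letters\<close>

lemma permsD:
  assumes "\<sigma> \<in> perms n"
  shows "set \<sigma> = {1..n}" "distinct \<sigma>" "length \<sigma> = n"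
  using assms by (auto simp: permutations_of_set_def dest: distinct_card)

lemma remove_top_perms:
  assumes "\<sigma> \<in> perms n"
  shows "set (remove_top r \<sigma>) = {Suc r..n}" "distinct (remove_top r \<sigma>)"
    "length (remove_top r \<sigma>) = n - r"
proof -
  note \<sigma> = permsD[OF assms]
  \<comment> \<open>Truncated subtraction is harmless: if \<open>r > n\<close>, both sides are
    empty.\<close>
  have "(+) r ` {1..n - r} = {Suc r..n}" by (cases "r \<le> n") auto
  then show "set (remove_top r \<sigma>) = {Suc r..n}"
    using set_standardise[of "drop r \<sigma>"] \<sigma> by (simp add: remove_top_def)
  show "distinct (remove_top r \<sigma>)"
    using distinct_standardise[of "drop r \<sigma>"] \<sigma> by (simp add: remove_top_def distinct_map)
  show "length (remove_top r \<sigma>) = n - r"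
    using \<sigma> by (simp add: remove_top_def)
qed

subsection \<open>Inserting a new smallest letter\<close>

text \<open>The window is measured from the end so that one \<open>h\<close> applies to words before
  and after an insertion, whose lengths differ. A word shorter than \<open>m\<close> is standardised
  as a whole.\<close>

definition tail_function :: "nat \<Rightarrow> (nat list \<Rightarrow> real) \<Rightarrow> nat list \<Rightarrow> real" where
  "tail_function m h xs = h (standardise (drop (length xs - m) xs))"

text \<open>For \<open>m = 0\<close> the condition is vacuous; that case covers the constant eigenfunction and the
  cardinality of \<open>insertions\<close>.\<close>

definition insertion_null :: "nat \<Rightarrow> (nat list \<Rightarrow> real) \<Rightarrow> bool" where
  "insertion_null m h \<longleftrightarrow>
     (\<forall>xs. Suc (length xs) = m \<and> 1 \<notin> set xs \<longrightarrow> (\<Sum>p<m. h (insert_at p 1 xs)) = 0)"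

lemma sum_tail_function_insert_at:
  assumes "insertion_null m h" "m \<le> Suc (length xs)"
    and "distinct xs" "\<And>x. x \<in> set xs \<Longrightarrow> a < x"
  shows "(\<Sum>p\<le>length xs. tail_function m h (insert_at p a xs)) =
    (real (Suc (length xs)) - real m) * tail_function m h xs"
proof -
  \<comment> \<open>Positions \<open>p < k\<close> put \<open>a\<close> before the last
    \<open>m\<close> letters of the longer word. For \<open>m = Suc (length xs)\<close> there are
    none, and the factor in the claim is 0.\<close>
  define k where "k = Suc (length xs) - m"
  have before: "tail_function m h (insert_at p a xs) = tail_function m h xs" if "p < k" for p
  proof -
    have "length xs - m = k - 1" "k \<le> Suc (length xs)" "Suc (length xs) - m = k"
      using assms(2) by (auto simp: k_def)
    moreover have "drop k (insert_at p a xs) = drop (k - 1) xs"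
      using that \<open>k \<le> Suc (length xs)\<close> by (simp add: insert_at_def drop_Cons' min_def)
    ultimately show ?thesis by (simp add: tail_function_def)
  qed
  have after: "tail_function m h (insert_at (k + p) a xs) =
      h (insert_at p 1 (map Suc (standardise (drop k xs))))" if "p < m" for p
  proof -
    have "drop k (insert_at (k + p) a xs) = insert_at p a (drop k xs)"
      using that assms(2) by (simp add: k_def insert_at_def drop_take add.commute)
    then show ?thesis
      using standardise_insert_at[of "drop k xs" a p] assms(3,4)
      by (simp add: tail_function_def k_def in_set_dropD)
  qed
  have "{..length xs} = {..<k} \<union> {k..<k + m}" using assms(2) by (auto simp: k_def)
  then have "(\<Sum>p\<le>length xs. tail_function m h (insert_at p a xs)) =
      (\<Sum>p<k. tail_function m h (insert_at p a xs)) +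
      (\<Sum>p\<in>{k..<k + m}. tail_function m h (insert_at p a xs))"
    by (simp only:) (rule sum.union_disjoint, auto)
  also have "(\<Sum>p<k. tail_function m h (insert_at p a xs)) = real k * tail_function m h xs"
    by (simp add: before)
  also have "(\<Sum>p\<in>{k..<k + m}. tail_function m h (insert_at p a xs)) =
      (\<Sum>p<m. tail_function m h (insert_at (k + p) a xs))"
    using sum.shift_bounds_nat_ivl[of "\<lambda>p. tail_function m h (insert_at p a xs)" 0 k m]
    by (simp add: add.commute lessThan_atLeast0)
  also have "\<dots> = (\<Sum>p<m. h (insert_at p 1 (map Suc (standardise (drop k xs)))))"
    by (simp add: after)
  also have "\<dots> = 0"
  \<comment> \<open>For \<open>m = 0\<close> the sum is empty. Otherwise the standardised window,
    shifted up by one, is a word of length \<open>m - 1\<close> avoiding 1, as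
    \<open>insertion_null\<close> asks.\<close>
  proof (cases "m = 0")
    case False
    then have "Suc (length (map Suc (standardise (drop k xs)))) = m"
      using assms(2) by (simp add: k_def)
    moreover have "1 \<notin> set (map Suc (standardise (drop k xs)))"
      using set_standardise[of "drop k xs"] assms(3) by auto
    ultimately show ?thesis using assms(1) by (simp add: insertion_null_def)
  qed simp
  finally show ?thesis using assms(2) by (simp add: k_def of_nat_diff)
qed

section \<open>Inserting the letters \<open>r\<close>, ..., 1 in turn\<close>

text \<open>For \<open>w = remove_top r \<sigma>\<close> this is the set sampled by the binomial
  chain. A general \<open>w\<close> is allowed for the induction on \<open>r\<close>.\<close>

definition insertions :: "nat \<Rightarrow> nat \<Rightarrow> nat list \<Rightarrow> nat list set" where
  "insertions n r w = {\<rho> \<in> perms n. filter (\<lambda>a. r < a) \<rho> = w}"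

lemma finite_insertions [simp]: "finite (insertions n r w)"
  by (simp add: insertions_def)

text \<open>In a member of the left-hand set, the letters above \<open>r\<close> form
  \<open>w\<close> with \<open>Suc r\<close> put somewhere; that place is \<open>p\<close>.\<close>

lemma insertions_Suc:
  assumes "r < n" "Suc r \<notin> set w"
  shows "insertions n (Suc r) w = (\<Union>p\<le>length w. insertions n r (insert_at p (Suc r) w))"
proof (intro equalityI subsetI)
  fix \<rho> assume "\<rho> \<in> insertions n (Suc r) w"
  then have \<rho>: "\<rho> \<in> perms n" "filter (\<lambda>a. Suc r < a) \<rho> = w" by (auto simp: insertions_def)
  have "Suc r \<in> set (filter (\<lambda>a. r < a) \<rho>)"
    using permsD[OF \<rho>(1)] assms(1) by auto
  then obtain us vs where uv: "filter (\<lambda>a. r < a) \<rho> = us @ Suc r # vs"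
    by (meson split_list)
  have "distinct (us @ Suc r # vs)" "\<forall>x\<in>set (us @ Suc r # vs). r < x"
    using permsD(2)[OF \<rho>(1)] unfolding uv[symmetric] by auto
  then have gt: "Suc r < x" if "x \<in> set us \<union> set vs" for x
    using that by (intro Suc_lessI) auto
  have "w = filter (\<lambda>a. Suc r < a) (filter (\<lambda>a. r < a) \<rho>)"
    unfolding \<rho>(2)[symmetric] by (auto intro: filter_cong)
  also have "\<dots> = us @ vs" unfolding uv using gt by (simp add: filter_id_conv)
  finally have "filter (\<lambda>a. r < a) \<rho> = insert_at (length us) (Suc r) w" "length us \<le> length w"
    using uv by auto
  then show "\<rho> \<in> (\<Union>p\<le>length w. insertions n r (insert_at p (Suc r) w))"
    using \<rho>(1) by (auto simp: insertions_def)
next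
  fix \<rho> assume "\<rho> \<in> (\<Union>p\<le>length w. insertions n r (insert_at p (Suc r) w))"
  then obtain p where p: "\<rho> \<in> perms n" "filter (\<lambda>a. r < a) \<rho> = insert_at p (Suc r) w"
    by (auto simp: insertions_def)
  have "filter (\<lambda>a. Suc r < a) \<rho> = filter (\<lambda>a. a \<noteq> Suc r) (filter (\<lambda>a. r < a) \<rho>)"
    by (auto intro: filter_cong)
  also have "\<dots> = w"
    unfolding p(2) filter_insert_at using assms(2) by (auto simp: filter_id_conv)
  finally show "\<rho> \<in> insertions n (Suc r) w" using p(1) by (simp add: insertions_def)
qed

text \<open>The letter \<open>Suc r\<close> is inserted first, into a word of length
  \<open>n - Suc r\<close>, and contributes the factor \<open>(n - m) - r\<close>. The smaller
  letters are covered by the induction hypothesis.\<close>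

lemma sum_insertions_tail_function:
  assumes "insertion_null m h" "m \<le> n" "r \<le> n" "distinct w" "set w = {Suc r..n}"
  shows "(\<Sum>\<rho>\<in>insertions n r w. tail_function m h \<rho>) =
    (\<Prod>i=0..<r. real (n - m) - real i) * tail_function m h w"
  using assms(3-)
proof (induction r arbitrary: w)
  case 0
  have "filter (\<lambda>a. 0 < a) \<rho> = \<rho>" if "\<rho> \<in> perms n" for \<rho>
    using permsD(1)[OF that] by (auto simp: filter_id_conv)
  moreover have "w \<in> perms n" using 0 by (auto simp: permutations_of_set_def)
  ultimately have "insertions n 0 w = {w}" by (auto simp: insertions_def)
  then show ?case by simp
next
  case (Suc r)
  have len: "Suc (length w) = n - r"
    using distinct_card[OF Suc.prems(2)] Suc.prems by simp
  have notin: "Suc r \<notin> set w" using Suc.prems by simp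
  have IH: "(\<Sum>\<rho>\<in>insertions n r (insert_at p (Suc r) w). tail_function m h \<rho>) =
      (\<Prod>i=0..<r. real (n - m) - real i) * tail_function m h (insert_at p (Suc r) w)" for p
    using Suc.prems notin by (intro Suc.IH) (simp_all add: Icc_eq_insert_lb_nat[of "Suc r"])
  \<comment> \<open>The pieces for different \<open>p\<close> are disjoint, since by
    \<open>insert_at_inject\<close> their filtered words differ.\<close>
  have "(\<Sum>\<rho>\<in>insertions n (Suc r) w. tail_function m h \<rho>) =
      (\<Sum>p\<le>length w. \<Sum>\<rho>\<in>insertions n r (insert_at p (Suc r) w). tail_function m h \<rho>)"
    unfolding insertions_Suc[OF Suc_le_lessD[OF Suc.prems(1)] notin]
    using insert_at_inject[OF notin notin]
    by (intro sum.UNION_disjoint) (auto simp: insertions_def)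
  also have "\<dots> = (\<Prod>i=0..<r. real (n - m) - real i) *
      (\<Sum>p\<le>length w. tail_function m h (insert_at p (Suc r) w))"
    by (simp add: IH sum_distrib_left)
  also have "\<dots> = (\<Prod>i=0..<r. real (n - m) - real i) *
      ((real (n - m) - real r) * tail_function m h w)"
  \<comment> \<open>If \<open>r > n - m\<close>, the word is too short for
    \<open>sum_tail_function_insert_at\<close>, but the product already contains the zero factor at
    \<open>i = n - m\<close>.\<close>
  proof (cases "r \<le> n - m")
    case True
    then have "m \<le> Suc (length w)" using len assms(2) Suc.prems(1) by linarith
    then have "(\<Sum>p\<le>length w. tail_function m h (insert_at p (Suc r) w)) =
        (real (Suc (length w)) - real m) * tail_function m h w"
      using assms(1) Suc.prems by (intro sum_tail_function_insert_at) auto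
    moreover have "real (Suc (length w)) - real m = real (n - m) - real r"
      using len assms(2) Suc.prems(1) by (simp add: of_nat_diff)
    ultimately show ?thesis by simp
  next
    case False
    then have "(\<Prod>i=0..<r. real (n - m) - real i) = 0"
      by (intro prod_zero) (auto intro!: bexI[of _ "n - m"])
    then show ?thesis by simp
  qed
  finally show ?case by simp
qed

text \<open>For \<open>m = 0\<close> and the constant function 1 the sum counts the set; the value
  is the falling factorial of \<open>n\<close> of order \<open>r\<close>.\<close>

lemma card_insertions:
  assumes "r \<le> n" "distinct w" "set w = {Suc r..n}"
  shows "real (card (insertions n r w)) = (\<Prod>i=0..<r. real n - real i)"
  using sum_insertions_tail_function[of 0 "\<lambda>_. 1", OF _ _ assms]
  by (simp add: insertion_null_def tail_function_def)

subsection \<open>The eigenfunctions\<close>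

text \<open>With \<open>j = fixed_prefix n \<tau>\<close>, the prefix contains only
  \<open>1, ..., j\<close>, so the letter \<open>j + 1\<close> lies further right, and
  \<open>us\<close> is nonempty because position \<open>j + 1\<close> is not fixed. This normal form
  replaces the least choice in \<open>fixed_prefix\<close>.\<close>

lemma fixed_prefix_decomposition:
  assumes "\<tau> \<in> perms n" "\<tau> \<noteq> id_perm n"
  obtains us vs where "us \<noteq> []"
    "\<tau> = [1..<Suc (fixed_prefix n \<tau>)] @ us @ Suc (fixed_prefix n \<tau>) # vs"
proof -
  note \<tau> = permsD[OF assms(1)]
  define P where "P k \<longleftrightarrow> k \<in> {1..n} \<and> letter \<tau> k \<noteq> k" for k
  define k where "k = (LEAST k. P k)"
  define j where "j = fixed_prefix n \<tau>"
  have "\<exists>k. P k"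
  proof (rule ccontr)
    assume *: "\<not> (\<exists>k. P k)"
    have "\<tau> ! i = id_perm n ! i" if "i < n" for i
      using *[unfolded P_def letter_def not_ex, rule_format, of "Suc i"] that
      by (simp add: id_perm_def del: upt_Suc)
    then have "\<tau> = id_perm n"
      using \<tau>(3) by (intro nth_equalityI) (auto simp: id_perm_def simp del: upt_Suc)
    then show False using assms(2) by simp
  qed
  then have Pk: "P k" unfolding k_def by (rule LeastI_ex)
  have least: "\<not> P i" if "i < k" for i using that not_less_Least unfolding k_def by blast
  have kj: "k = Suc j" "Suc j \<le> n"
    using assms(2) Pk by (auto simp: j_def fixed_prefix_def k_def P_def)
  have prefix: "take j \<tau> = [1..<Suc j]"
  proof (rule nth_equalityI)
    fix i assume "i < length (take j \<tau>)"
    then show "take j \<tau> ! i = [1..<Suc j] ! i"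
      using least[of "Suc i"] kj by (simp add: P_def letter_def del: upt_Suc)
  qed (use \<tau> kj in simp)
  have "Suc j \<in> set (take j \<tau> @ drop j \<tau>)" using kj \<tau> by simp
  then have "Suc j \<in> set (drop j \<tau>)" unfolding set_append prefix by simp
  then obtain us vs where uv: "drop j \<tau> = us @ Suc j # vs" by (meson split_list)
  have "us \<noteq> []"
  proof
    assume "us = []"
    then have "\<tau> ! j = Suc j" using uv \<tau>(3) kj by (metis Cons_nth_drop_Suc Suc_le_lessD append_Nil list.inject)
    then show False using Pk kj by (simp add: P_def letter_def)
  qed
  moreover have "\<tau> = [1..<Suc j] @ us @ Suc j # vs"
    using append_take_drop_id[of j \<tau>] unfolding prefix uv by (rule sym)
  ultimately show ?thesis unfolding j_def by (rule that)
qed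

lemma set_drop_perms:
  assumes "\<tau> \<in> perms n" "\<tau> = [1..<Suc j] @ ys"
  shows "set ys = {Suc j..n}" "distinct ys" "n = j + length ys"
proof -
  note \<tau> = permsD[OF assms(1)]
  have "set [1..<Suc j] \<union> set ys = {1..n}" "set [1..<Suc j] \<inter> set ys = {}"
    using \<tau> assms(2) by (metis set_append, metis distinct_append)
  moreover have "{1..n} - {1..<Suc j} = {Suc j..n}" by auto
  moreover have "set [1..<Suc j] = {1..<Suc j}" by (rule set_upt)
  ultimately show "set ys = {Suc j..n}" by blast
  show "distinct ys" "n = j + length ys" using \<tau> assms(2) by auto
qed

lemma position_eq:
  assumes "\<tau> \<in> perms n" "\<tau> = xs @ a # ys"
  shows "position n \<tau> a = Suc (length xs)"
  unfolding position_def
proof (rule the_equality)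
  note \<tau> = permsD[OF assms(1)]
  show "Suc (length xs) \<in> {1..n} \<and> letter \<tau> (Suc (length xs)) = a"
    using \<tau>(3) assms(2) by (auto simp: letter_def)
  fix i assume i: "i \<in> {1..n} \<and> letter \<tau> i = a"
  then have "\<tau> ! (i - 1) = \<tau> ! length xs" "i - 1 < length \<tau>" "length xs < length \<tau>"
    using \<tau>(3) assms(2) by (auto simp: letter_def)
  then have "i - 1 = length xs" using \<tau>(2) nth_eq_iff_index_eq by blast
  then show "i = Suc (length xs)" using i by auto
qed

lemma eigfun_id_perm: "\<sigma> \<in> perms n \<Longrightarrow> eigfun n (id_perm n) \<sigma> = 1"
  by (simp add: eigfun_def)

text \<open>Here \<open>us\<close> consists of the letters of \<open>\<tau>\<close> in positions
  \<open>j + 1\<close> to \<open>i - 1\<close>; the second pattern moves the letter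
  \<open>Suc j\<close> from behind \<open>us\<close> to its front.\<close>

lemma eigfun_not_id_perm:
  assumes "\<tau> \<in> perms n" "\<tau> \<noteq> id_perm n" "\<sigma> \<in> perms n"
    and "\<tau> = [1..<Suc j] @ us @ Suc j # vs" "j = fixed_prefix n \<tau>"
  shows "eigfun n \<tau> \<sigma> =
    (if standardise (drop j \<sigma>) = standardise (us @ Suc j # vs) then 1
     else if standardise (drop j \<sigma>) = standardise (Suc j # us @ vs) then - 1 else 0)"
proof -
  define i where "i = position n \<tau> (Suc j)"
  have i: "i = Suc (j + length us)"
    using position_eq[OF assms(1), of "[1..<Suc j] @ us" "Suc j" vs] assms(4)
    by (simp add: i_def del: upt_Suc)
  have "drop j \<tau> = us @ Suc j # vs" "drop j (take (i - 1) \<tau>) = us" "drop i \<tau> = vs"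
    by (subst assms(4); simp add: i del: upt_Suc)+
  then show ?thesis
    using assms(2,3)
    unfolding eigfun_def Let_def same_relative_order_def assms(5)[symmetric] Suc_eq_plus1[symmetric]
      i_def[symmetric]
    by simp
qed

lemma fixed_prefix_id_perm [simp]: "fixed_prefix n (id_perm n) = n"
  by (simp add: fixed_prefix_def)

lemma fixed_prefix_less:
  assumes "\<tau> \<in> perms n" "\<tau> \<noteq> id_perm n"
  shows "fixed_prefix n \<tau> < n"
proof -
  obtain us vs where "\<tau> = [1..<Suc (fixed_prefix n \<tau>)] @ us @ Suc (fixed_prefix n \<tau>) # vs"
    using fixed_prefix_decomposition[OF assms] by metis
  from set_drop_perms(3)[OF assms(1) this] show ?thesis by simp
qed

lemma fixed_prefix_le: "\<tau> \<in> perms n \<Longrightarrow> fixed_prefix n \<tau> \<le> n"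
  by (cases "\<tau> = id_perm n") (auto simp: fixed_prefix_less less_imp_le)

lemma eigfun_outside: "\<sigma> \<notin> perms n \<Longrightarrow> eigfun n \<tau> \<sigma> = 0"
  by (simp add: eigfun_def)

text \<open>Both patterns come from the one word \<open>us @ vs\<close> by inserting a new smallest
  letter, at place \<open>length us\<close> and at place 0. This is what makes the insertion sum
  vanish.\<close>

lemma eigfun_eq_tail_function:
  assumes "\<tau> \<in> perms n"
  obtains h where "insertion_null (n - fixed_prefix n \<tau>) h"
    "\<And>\<sigma>. \<sigma> \<in> perms n \<Longrightarrow> eigfun n \<tau> \<sigma> = tail_function (n - fixed_prefix n \<tau>) h \<sigma>"
proof (cases "\<tau> = id_perm n")
  case True
  \<comment> \<open>The identity has \<open>fixed_prefix\<close> equal to \<open>n\<close>, so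
    \<open>m = 0\<close> and the window is empty.\<close>
  show ?thesis
    by (rule that[of "\<lambda>_. 1"]) (simp_all add: True insertion_null_def tail_function_def eigfun_id_perm)
next
  case False
  define j where "j = fixed_prefix n \<tau>"
  obtain us vs where uv: "us \<noteq> []" "\<tau> = [1..<Suc j] @ us @ Suc j # vs"
    using fixed_prefix_decomposition[OF assms False] unfolding j_def by metis
  note ys = set_drop_perms[OF assms uv(2)]
  have dist: "distinct (us @ vs)" "Suc j \<notin> set (us @ vs)" using ys(2) by auto
  then have gt: "Suc j < x" if "x \<in> set (us @ vs)" for x
    using that ys(1) by (intro le_neq_implies_less) auto
  define g where "g = map Suc (standardise (us @ vs))"
  have g: "1 \<notin> set g" "length g = length us + length vs"
    using set_standardise[OF dist(1)] by (auto simp: g_def)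
  have \<alpha>: "standardise (us @ Suc j # vs) = insert_at (length us) 1 g"
    using standardise_insert_at[OF dist(1) gt, of "length us"] by (simp add: g_def)
  have \<alpha>': "standardise (Suc j # us @ vs) = insert_at 0 1 g"
    using standardise_insert_at[OF dist(1) gt, of 0] by (simp add: g_def insert_at_def)
  define h :: "nat list \<Rightarrow> real" where
    "h \<beta> = of_bool (\<beta> = insert_at (length us) 1 g) - of_bool (\<beta> = insert_at 0 1 g)" for \<beta>
  \<comment> \<open>As \<open>us\<close> is nonempty the two patterns differ, so the nested
    conditional in \<open>eigfun\<close> equals the difference \<open>h\<close> of
    indicators.\<close>
  have ne: "insert_at (length us) 1 g \<noteq> insert_at 0 1 g"
    using insert_at_inject[OF g(1) g(1), of "length us" 0] uv(1) g(2) by simp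
  have m: "n - j = Suc (length g)" using ys(3) g(2) by simp
  have "insertion_null (n - j) h"
    unfolding insertion_null_def
  proof (intro allI impI)
    fix xs :: "nat list" assume xs: "Suc (length xs) = n - j \<and> 1 \<notin> set xs"
    \<comment> \<open>For each target place \<open>q\<close> only \<open>p = q\<close> can match,
      and it does so precisely when \<open>xs = g\<close>. The count does not depend on
      \<open>q\<close>, hence the two indicators cancel.\<close>
    have "(\<Sum>p<n - j. of_bool (insert_at p 1 xs = insert_at q 1 g)) = (of_bool (xs = g) :: real)"
      if "q \<le> length g" for q
    proof -
      have "(\<Sum>p<n - j. of_bool (insert_at p 1 xs = insert_at q 1 g)) =
          (\<Sum>p<n - j. if p = q then of_bool (xs = g) else 0 :: real)"
        using xs m that g(1) by (intro sum.cong) (auto simp: insert_at_inject)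
      also have "\<dots> = of_bool (xs = g)" using that m by simp
      finally show ?thesis .
    qed
    then show "(\<Sum>p<n - j. h (insert_at p 1 xs)) = 0"
      using g(2) by (simp add: h_def sum_subtractf)
  qed
  moreover have "eigfun n \<tau> \<sigma> = tail_function (n - j) h \<sigma>" if "\<sigma> \<in> perms n" for \<sigma>
  proof -
    have "length \<sigma> - (n - j) = j" using permsD(3)[OF that] ys(3) by simp
    then show ?thesis
      using eigfun_not_id_perm[OF assms False that uv(2) j_def] ne
      by (simp only: \<alpha> \<alpha>' tail_function_def h_def) (simp split: if_splits)
  qed
  ultimately show ?thesis unfolding j_def by (rule that)
qed

text \<open>With a common \<open>j < n\<close> both suffixes use the alphabet
  \<open>{Suc j..n}\<close>, so relative order determines them. The value -1 would put the letter
  \<open>Suc j\<close> of \<open>\<sigma>\<close> in position \<open>Suc j\<close>. For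
  \<open>j = n\<close> both are the identity.\<close>

lemma eigfun_same_fixed_prefix:
  assumes "\<tau> \<in> perms n" "\<sigma> \<in> perms n" "fixed_prefix n \<tau> = fixed_prefix n \<sigma>"
  shows "eigfun n \<tau> \<sigma> = of_bool (\<tau> = \<sigma>)"
proof (cases "\<tau> = id_perm n")
  case True
  then have "\<sigma> = id_perm n"
    using assms fixed_prefix_less[of \<sigma> n] by (metis fixed_prefix_id_perm less_irrefl)
  with True assms(2) show ?thesis by (simp add: eigfun_id_perm)
next
  case False
  then have \<sigma>: "\<sigma> \<noteq> id_perm n"
    using assms fixed_prefix_less[of \<tau> n] by (metis fixed_prefix_id_perm less_irrefl)
  define j where "j = fixed_prefix n \<tau>"
  obtain us vs where uv: "us \<noteq> []" "\<tau> = [1..<Suc j] @ us @ Suc j # vs"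
    using fixed_prefix_decomposition[OF assms(1) False] unfolding j_def by metis
  obtain us' vs' where uv': "us' \<noteq> []" "\<sigma> = [1..<Suc j] @ us' @ Suc j # vs'"
    using fixed_prefix_decomposition[OF assms(2) \<sigma>] unfolding j_def assms(3) by metis
  note ys = set_drop_perms[OF assms(1) uv(2)]
  note ys' = set_drop_perms[OF assms(2) uv'(2)]
  have drop: "drop j \<sigma> = us' @ Suc j # vs'"
    by (subst uv'(2)) (simp del: upt_Suc)
  have "standardise (drop j \<sigma>) = standardise (us @ Suc j # vs) \<longleftrightarrow> drop j \<sigma> = us @ Suc j # vs"
    unfolding drop using ys(1) ys'(1) by (intro standardise_eq_iff_of_set_eq) simp
  also have "\<dots> \<longleftrightarrow> \<tau> = \<sigma>"
    unfolding drop by (subst uv(2), subst uv'(2)) auto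
  finally have 1: "standardise (drop j \<sigma>) = standardise (us @ Suc j # vs) \<longleftrightarrow> \<tau> = \<sigma>" .
  have "standardise (drop j \<sigma>) = standardise (Suc j # us @ vs) \<longleftrightarrow> drop j \<sigma> = Suc j # us @ vs"
    unfolding drop using ys(1) ys'(1) by (intro standardise_eq_iff_of_set_eq) simp
  moreover have "drop j \<sigma> \<noteq> Suc j # us @ vs"
    unfolding drop using uv'(1) ys'(2) by (cases us') auto
  ultimately show ?thesis
    using eigfun_not_id_perm[OF assms(1) False assms(2) uv(2) j_def] 1 by simp
qed

section \<open>The eigenvalues of the two chains\<close>

text \<open>Since \<open>f\<close> vanishes outside \<open>S\<close>, the finite sum is an
  expectation, which can be computed from the sampling description of the chain.\<close>

lemma right_eigenfunctionI:
  assumes "finite S" "\<And>y. y \<notin> S \<Longrightarrow> f y = 0"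
    and "\<And>x. x \<in> S \<Longrightarrow> measure_pmf.expectation (step x) f = \<beta> * f x"
  shows "right_eigenfunction S (transition_matrix step) \<beta> f"
  unfolding right_eigenfunction_def transition_matrix_def
proof
  fix x assume "x \<in> S"
  have "measure_pmf.expectation (step x) f = (\<Sum>y\<in>S. pmf (step x) y *\<^sub>R f y)"
    using assms(1,2) by (intro integral_measure_pmf) auto
  then show "(\<Sum>y\<in>S. pmf (step x) y * f y) = \<beta> * f x" using assms(3)[OF \<open>x \<in> S\<close>] by simp
qed

text \<open>The bound says that the removed letters lie before the last \<open>m\<close>; it also
  makes the truncated differences of lengths agree.\<close>

lemma tail_function_remove_top:
  assumes "\<sigma> \<in> perms n" "m + r \<le> n"
  shows "tail_function m h (remove_top r \<sigma>) = tail_function m h \<sigma>"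
proof -
  have "n - r - m + r = n - m" using assms(2) by simp
  then show ?thesis
    using remove_top_perms(3)[OF assms(1), of r] permsD(3)[OF assms(1)]
    by (simp add: tail_function_def standardise_drop_remove_top)
qed

lemma right_eigenfunction_top_to_random_std:
  assumes "n > 0" "\<tau> \<in> perms n"
  shows "right_eigenfunction (perms n) (transition_matrix (top_to_random_std n))
    (real (fixed_prefix n \<tau>) / real n) (eigfun n \<tau>)"
proof (rule right_eigenfunctionI)
  fix \<sigma> assume \<sigma>: "\<sigma> \<in> perms n"
  define j where "j = fixed_prefix n \<tau>"
  have jn: "j \<le> n" using fixed_prefix_le[OF assms(2)] by (simp add: j_def)
  obtain h where h: "insertion_null (n - j) h"
    "\<And>\<sigma>. \<sigma> \<in> perms n \<Longrightarrow> eigfun n \<tau> \<sigma> = tail_function (n - j) h \<sigma>"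
    using eigfun_eq_tail_function[OF assms(2)] unfolding j_def by metis
  note w = remove_top_perms[OF \<sigma>, of 1]
  have "insert_at p 1 (remove_top 1 \<sigma>) \<in> perms n" for p
    using w assms(1) by (intro permutations_of_setI) (simp_all add: Icc_eq_insert_lb_nat[of "Suc 0"])
  then have "measure_pmf.expectation (top_to_random_std n \<sigma>) (eigfun n \<tau>) =
      (\<Sum>p<n. tail_function (n - j) h (insert_at p 1 (remove_top 1 \<sigma>))) / real n"
    using assms(1) by (simp add: top_to_random_std_def integral_pmf_of_set h(2) lessThan_empty_iff)
  also have "{..<n} = {..length (remove_top 1 \<sigma>)}" using w(3) assms(1) by auto
  also have "(\<Sum>p\<le>length (remove_top 1 \<sigma>).
        tail_function (n - j) h (insert_at p 1 (remove_top 1 \<sigma>))) =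
      (real (Suc (length (remove_top 1 \<sigma>))) - real (n - j)) * tail_function (n - j) h (remove_top 1 \<sigma>)"
    using w h(1) by (intro sum_tail_function_insert_at) auto
  also have "real (Suc (length (remove_top 1 \<sigma>))) - real (n - j) = real j"
    using w(3) assms(1) jn by (simp add: of_nat_diff)
  \<comment> \<open>For \<open>j = 0\<close> the removed letter belongs to the window, so the two
    values may differ, but the factor 0 settles the case.\<close>
  also have "real j * tail_function (n - j) h (remove_top 1 \<sigma>) = real j * eigfun n \<tau> \<sigma>"
    using tail_function_remove_top[OF \<sigma>, of "n - j" 1 h] h(2)[OF \<sigma>] jn by (cases "j = 0") auto
  finally show "measure_pmf.expectation (top_to_random_std n \<sigma>) (eigfun n \<tau>) =
      real (fixed_prefix n \<tau>) / real n * eigfun n \<tau> \<sigma>"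
    by (simp add: j_def)
qed (simp_all add: eigfun_outside)

lemma right_eigenfunction_binomial_top_to_random_std:
  assumes "0 \<le> q" "q \<le> 1" "\<tau> \<in> perms n"
  shows "right_eigenfunction (perms n) (transition_matrix (binomial_top_to_random_std n q))
    (q ^ (n - fixed_prefix n \<tau>)) (eigfun n \<tau>)"
proof (rule right_eigenfunctionI)
  fix \<sigma> assume \<sigma>: "\<sigma> \<in> perms n"
  define j where "j = fixed_prefix n \<tau>"
  have jn: "j \<le> n" using fixed_prefix_le[OF assms(3)] by (simp add: j_def)
  obtain h where h: "insertion_null (n - j) h"
    "\<And>\<sigma>. \<sigma> \<in> perms n \<Longrightarrow> eigfun n \<tau> \<sigma> = tail_function (n - j) h \<sigma>"
    using eigfun_eq_tail_function[OF assms(3)] unfolding j_def by metis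
  define U where "U r = insertions n r (remove_top r \<sigma>)" for r
  have cardU: "real (card (U r)) = fact r * real (n choose r)" if "r \<le> n" for r
    using card_insertions[OF that remove_top_perms(2,1)[OF \<sigma>]]
    by (simp add: U_def binomial_gbinomial gbinomial_mult_fact)
  have U_ne: "U r \<noteq> {}" if "r \<le> n" for r
    using cardU[OF that] that by (intro notI) simp
  \<comment> \<open>Sum and cardinality involve the falling factorials of \<open>j\<close> and
    \<open>n\<close> of order \<open>r\<close>, and \<open>fact r\<close> cancels from the quotient.
    For \<open>r > j\<close> the removal reaches into the window, but then \<open>j choose r\<close>
    is 0.\<close>
  have step: "measure_pmf.expectation (pmf_of_set (U r)) (eigfun n \<tau>) =
      real (j choose r) / real (n choose r) * eigfun n \<tau> \<sigma>" if "r \<le> n" for r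
  proof -
    have "(\<Sum>\<rho>\<in>U r. eigfun n \<tau> \<rho>) = (\<Sum>\<rho>\<in>U r. tail_function (n - j) h \<rho>)"
      by (intro sum.cong) (auto simp: U_def insertions_def h(2))
    also have "\<dots> = fact r * real (j choose r) * tail_function (n - j) h (remove_top r \<sigma>)"
      using sum_insertions_tail_function[OF h(1) _ that remove_top_perms(2,1)[OF \<sigma>]] jn
      by (simp add: U_def binomial_gbinomial gbinomial_mult_fact)
    also have "\<dots> = fact r * real (j choose r) * eigfun n \<tau> \<sigma>"
      using tail_function_remove_top[OF \<sigma>, of "n - j" r h] h(2)[OF \<sigma>] jn
      by (cases "r \<le> j") auto
    finally show ?thesis
      using U_ne[OF that] cardU[OF that] by (simp add: integral_pmf_of_set U_def)
  qed
  have "measure_pmf.expectation (binomial_top_to_random_std n q \<sigma>) (eigfun n \<tau>) =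
      (\<Sum>r\<le>n. pmf (binomial_pmf n (1 - q)) r *\<^sub>R
        measure_pmf.expectation (pmf_of_set (U r)) (eigfun n \<tau>))"
    unfolding binomial_top_to_random_std_def insertions_def[symmetric] U_def[symmetric]
    using assms(1,2) U_ne
    by (intro pmf_expectation_bind) (auto simp: set_pmf_binomial_eq U_def set_pmf_of_set split: if_splits)
  \<comment> \<open>The factor \<open>n choose r\<close> of the binomial weight cancels the
    denominator.\<close>
  also have "\<dots> = (\<Sum>r\<le>n. real (j choose r) * (1 - q) ^ r * q ^ (n - r)) * eigfun n \<tau> \<sigma>"
    unfolding sum_distrib_right
  proof (rule sum.cong)
    fix r assume "r \<in> {..n}"
    then show "pmf (binomial_pmf n (1 - q)) r *\<^sub>R
          measure_pmf.expectation (pmf_of_set (U r)) (eigfun n \<tau>) =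
        real (j choose r) * (1 - q) ^ r * q ^ (n - r) * eigfun n \<tau> \<sigma>"
      using assms(1,2) by (simp add: step)
  qed simp
  also have "(\<Sum>r\<le>n. real (j choose r) * (1 - q) ^ r * q ^ (n - r)) =
      (\<Sum>r\<le>j. real (j choose r) * (1 - q) ^ r * q ^ (n - r))"
    using jn by (intro sum.mono_neutral_right) auto
  \<comment> \<open>With \<open>q ^ (n - j)\<close> taken out, what remains is the expansion of
    \<open>((1 - q) + q) ^ j = 1\<close>.\<close>
  also have "\<dots> = (\<Sum>r\<le>j. q ^ (n - j) * (real (j choose r) * (1 - q) ^ r * q ^ (j - r)))"
    using jn by (intro sum.cong) (auto simp: power_add[symmetric])
  also have "\<dots> = q ^ (n - j)"
    using binomial_ring[of "1 - q" q j] by (simp add: sum_distrib_left[symmetric])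
  finally show "measure_pmf.expectation (binomial_top_to_random_std n q \<sigma>) (eigfun n \<tau>) =
      q ^ (n - fixed_prefix n \<tau>) * eigfun n \<tau> \<sigma>"
    by (simp add: j_def)
qed (simp_all add: eigfun_outside)

subsection \<open>Linear independence and spanning\<close>

text \<open>Applying \<open>K - \<beta> k\<close> to the vanishing sum kills \<open>F k\<close> and
  multiplies every other \<open>F i\<close> by \<open>\<beta> i - \<beta> k\<close>, which is
  nonzero by injectivity. The induction hypothesis handles the shorter sum. Stating this for sums
  allows some \<open>F j\<close> to be zero.\<close>

lemma sum_eigenfunctions_eq_0_imp:
  assumes "finite J" "inj_on \<beta> J"
    and "\<And>j. j \<in> J \<Longrightarrow> right_eigenfunction S K (\<beta> j) (F j)"
    and "\<And>x. x \<in> S \<Longrightarrow> (\<Sum>j\<in>J. F j x) = 0"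
    and "j \<in> J" "x \<in> S"
  shows "F j x = 0"
  using assms
proof (induction J arbitrary: F j x rule: finite_induct)
  case (insert k J)
  have eig: "(\<Sum>y\<in>S. K x y * F i y) = \<beta> i * F i x" if "i \<in> insert k J" "x \<in> S" for i x
    using insert.prems(2)[OF that(1)] that(2) by (simp add: right_eigenfunction_def)
  define G where "G i = (\<lambda>x. (\<beta> i - \<beta> k) * F i x)" for i
  have G: "G i x = 0" if "i \<in> J" "x \<in> S" for i x
  proof (rule insert.IH[OF _ _ _ that])
    show "inj_on \<beta> J" using insert.prems(1) by simp
    show "right_eigenfunction S K (\<beta> i) (G i)" if "i \<in> J" for i
      unfolding right_eigenfunction_def
    proof
      fix x assume "x \<in> S"
      have "(\<Sum>y\<in>S. K x y * G i y) = (\<beta> i - \<beta> k) * (\<Sum>y\<in>S. K x y * F i y)"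
        by (simp add: G_def sum_distrib_left mult_ac)
      then show "(\<Sum>y\<in>S. K x y * G i y) = \<beta> i * G i x"
        using eig[of i x] that \<open>x \<in> S\<close> by (simp add: G_def)
    qed
    show "(\<Sum>i\<in>J. G i x) = 0" if "x \<in> S" for x
    proof -
      have "(\<Sum>i\<in>insert k J. \<beta> i * F i x) = (\<Sum>i\<in>insert k J. \<Sum>y\<in>S. K x y * F i y)"
        using eig that by simp
      also have "\<dots> = (\<Sum>y\<in>S. K x y * (\<Sum>i\<in>insert k J. F i y))"
        unfolding sum_distrib_left by (rule sum.swap)
      also have "\<dots> = 0" using insert.prems(3) by simp
      finally have "(\<Sum>i\<in>insert k J. \<beta> i * F i x) - \<beta> k * (\<Sum>i\<in>insert k J. F i x) = 0"
        using insert.prems(3) that by simp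
      moreover have "(\<Sum>i\<in>insert k J. \<beta> i * F i x) - \<beta> k * (\<Sum>i\<in>insert k J. F i x) =
          (\<Sum>i\<in>insert k J. G i x)"
        by (simp only: sum_distrib_left sum_subtractf[symmetric] G_def left_diff_distrib)
      ultimately show ?thesis using insert.hyps by (simp add: G_def)
    qed
  qed
  have "F i x = 0" if "i \<in> J" "x \<in> S" for i x
  proof -
    have "\<beta> i \<noteq> \<beta> k" using insert.prems(1) insert.hyps that(1) by (auto simp: inj_on_def)
    then show ?thesis using G[OF that] by (simp add: G_def)
  qed
  moreover from this have "F k x = 0" if "x \<in> S" for x
    using insert.prems(3)[OF that] insert.hyps that by simp
  ultimately show ?case using insert.prems by auto
qed simp

lemma right_eigenfunction_sum:
  assumes "\<And>t. t \<in> T \<Longrightarrow> right_eigenfunction S K \<beta> (f t)"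
  shows "right_eigenfunction S K \<beta> (\<lambda>x. \<Sum>t\<in>T. c t * f t x)"
  unfolding right_eigenfunction_def
proof
  fix x assume "x \<in> S"
  have "(\<Sum>y\<in>S. K x y * (\<Sum>t\<in>T. c t * f t y)) = (\<Sum>t\<in>T. \<Sum>y\<in>S. K x y * (c t * f t y))"
    unfolding sum_distrib_left by (rule sum.swap)
  also have "\<dots> = (\<Sum>t\<in>T. c t * (\<Sum>y\<in>S. K x y * f t y))"
    by (simp add: sum_distrib_left mult_ac)
  also have "\<dots> = (\<Sum>t\<in>T. c t * (\<beta> * f t x))"
    using assms \<open>x \<in> S\<close> by (simp add: right_eigenfunction_def)
  finally show "(\<Sum>y\<in>S. K x y * (\<Sum>t\<in>T. c t * f t y)) = \<beta> * (\<Sum>t\<in>T. c t * f t x)"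
    by (simp add: sum_distrib_left mult_ac)
qed

text \<open>Grouping by \<open>fixed_prefix\<close> gives one eigenfunction for each
  \<open>j / n\<close>, and each of them vanishes. At \<open>\<tau>\<^sub>0\<close>, the group of
  its own \<open>j\<close> retains only \<open>c \<tau>\<^sub>0\<close> by
  \<open>eigfun_same_fixed_prefix\<close>.\<close>

lemma eigfun_coefficients_zero:
  assumes "n > 0" "\<And>\<sigma>. \<sigma> \<in> perms n \<Longrightarrow> (\<Sum>\<tau>\<in>perms n. c \<tau> * eigfun n \<tau> \<sigma>) = 0"
    and "\<tau>\<^sub>0 \<in> perms n"
  shows "c \<tau>\<^sub>0 = 0"
proof -
  define T where "T j = {\<tau> \<in> perms n. fixed_prefix n \<tau> = j}" for j
  \<comment> \<open>For \<open>j = n - 1\<close> the class \<open>T j\<close> is empty and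
    \<open>F j\<close> is 0, which still satisfies \<open>right_eigenfunction\<close>.\<close>
  define F where "F j = (\<lambda>\<sigma>. \<Sum>\<tau>\<in>T j. c \<tau> * eigfun n \<tau> \<sigma>)" for j
  let ?j = "fixed_prefix n \<tau>\<^sub>0"
  have "F ?j \<tau>\<^sub>0 = 0"
  proof (rule sum_eigenfunctions_eq_0_imp[where J = "{..n}" and \<beta> = "\<lambda>j. real j / real n"
        and S = "perms n" and K = "transition_matrix (top_to_random_std n)"])
    show "inj_on (\<lambda>j. real j / real n) {..n}" using assms(1) by (auto simp: inj_on_def)
    show "right_eigenfunction (perms n) (transition_matrix (top_to_random_std n))
        (real j / real n) (F j)" for j
      unfolding F_def
      using right_eigenfunction_top_to_random_std[OF assms(1)]
      by (intro right_eigenfunction_sum) (auto simp: T_def)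
    show "(\<Sum>j\<in>{..n}. F j \<sigma>) = 0" if "\<sigma> \<in> perms n" for \<sigma>
    proof -
      have "fixed_prefix n ` perms n \<subseteq> {..n}" using fixed_prefix_le by blast
      then show ?thesis
        using sum.group[of "perms n" "{..n}" "fixed_prefix n" "\<lambda>\<tau>. c \<tau> * eigfun n \<tau> \<sigma>"]
          assms(2)[OF that]
        by (simp only: F_def T_def finite_permutations_of_set finite_atMost)
    qed
    show "?j \<in> {..n}" using fixed_prefix_le[OF assms(3)] by simp
  qed (use assms(3) in simp_all)
  moreover have "F ?j \<tau>\<^sub>0 = (\<Sum>\<tau>\<in>T ?j. if \<tau> = \<tau>\<^sub>0 then c \<tau>\<^sub>0 else 0)"
    unfolding F_def using assms(3)
    by (intro sum.cong) (auto simp: T_def eigfun_same_fixed_prefix)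
  moreover have "\<dots> = c \<tau>\<^sub>0" using assms(3) by (simp add: T_def)
  ultimately show ?thesis by simp
qed

text \<open>Two equal functions would give a relation with coefficients 1 and -1 in the family
  indexed by permutations.\<close>

lemma inj_on_eigfun:
  assumes "n > 0"
  shows "inj_on (eigfun n) (perms n)"
proof (rule inj_onI, rule ccontr)
  fix \<tau> \<tau>' assume \<tau>: "\<tau> \<in> perms n" "\<tau>' \<in> perms n" "eigfun n \<tau> = eigfun n \<tau>'" "\<tau> \<noteq> \<tau>'"
  define c :: "nat list \<Rightarrow> real" where "c \<rho> = (if \<rho> = \<tau> then 1 else 0) - (if \<rho> = \<tau>' then 1 else 0)" for \<rho>
  have "(\<Sum>\<rho>\<in>perms n. c \<rho> * eigfun n \<rho> \<sigma>) = 0" for \<sigma>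
  proof -
    have "(\<Sum>\<rho>\<in>perms n. c \<rho> * eigfun n \<rho> \<sigma>) =
        (\<Sum>\<rho>\<in>perms n. if \<rho> = \<tau> then eigfun n \<tau> \<sigma> else 0) -
        (\<Sum>\<rho>\<in>perms n. if \<rho> = \<tau>' then eigfun n \<tau>' \<sigma> else 0)"
      unfolding sum_subtractf[symmetric] by (intro sum.cong) (auto simp: c_def)
    then show ?thesis using \<tau> by simp
  qed
  then have "c \<tau> = 0" using eigfun_coefficients_zero[OF assms _ \<tau>(1)] by blast
  then show False using \<tau>(4) by (simp add: c_def)
qed

lemma sum_fun_apply: "(\<Sum>i\<in>A. f i) x = (\<Sum>i\<in>A. f i x)"
  for f :: "'i \<Rightarrow> 'a \<Rightarrow> real"
  by (induction A rule: infinite_finite_induct) auto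

lemma independent_eigfun:
  assumes "n > 0"
  shows "funs.independent (eigfun n ` perms n)"
proof (rule funs.independent_if_scalars_zero)
  fix c f assume sum: "(\<Sum>f\<in>eigfun n ` perms n. fscale (c f) f) = 0" and "f \<in> eigfun n ` perms n"
  then obtain \<tau>\<^sub>0 where \<tau>\<^sub>0: "\<tau>\<^sub>0 \<in> perms n" "f = eigfun n \<tau>\<^sub>0" by auto
  have "(\<Sum>\<tau>\<in>perms n. c (eigfun n \<tau>) * eigfun n \<tau> \<sigma>) = 0" for \<sigma>
    using fun_cong[OF sum, of \<sigma>]
    unfolding sum.reindex[OF inj_on_eigfun[OF assms]] by (simp add: sum_fun_apply fscale_def)
  then show "c f = 0"
    using eigfun_coefficients_zero[OF assms, of "\<lambda>\<tau>. c (eigfun n \<tau>)"] \<tau>\<^sub>0 by blast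
qed simp

section \<open>Bases by a dimension count\<close>

lemma subspace_functions_on: "funs.subspace (functions_on S)"
  by (auto simp: funs.subspace_def functions_on_def fscale_def)

text \<open>A function outside the span could be added to \<open>B\<close>, giving
  \<open>card S + 1\<close> independent functions in the span of at most \<open>card S\<close>
  indicator functions.\<close>

lemma span_eq_functions_on:
  assumes "finite S" "B \<subseteq> functions_on S" "funs.independent B" "card B = card S"
  shows "funs.span B = functions_on S"
proof
  show "funs.span B \<subseteq> functions_on S"
    using assms(2) subspace_functions_on by (rule funs.span_minimal)
  define D where "D = (\<lambda>s x. if x = s then 1 else 0 :: real) ` S"
  have D: "functions_on S \<subseteq> funs.span D"
  proof
    fix f assume f: "f \<in> functions_on S"
    have "f = (\<Sum>s\<in>S. fscale (f s) (\<lambda>x. if x = s then 1 else 0))"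
    proof
      fix x
      have "(\<Sum>s\<in>S. f s * (if x = s then 1 else 0)) = (\<Sum>s\<in>S. if x = s then f x else 0)"
        by (intro sum.cong) auto
      also have "\<dots> = f x" using assms(1) f by (simp add: functions_on_def)
      finally show "f x = (\<Sum>s\<in>S. fscale (f s) (\<lambda>x. if x = s then 1 else 0)) x"
        by (simp add: sum_fun_apply fscale_def)
    qed
    also have "\<dots> \<in> funs.span D"
      by (intro funs.span_sum funs.span_scale funs.span_base) (auto simp: D_def)
    finally show "f \<in> funs.span D" .
  qed
  have finD: "finite D" "card D \<le> card S"
    using assms(1) by (auto simp: D_def card_image_le)
  show "functions_on S \<subseteq> funs.span B"
  proof (rule subsetI, rule ccontr)
    fix f assume f: "f \<in> functions_on S" "f \<notin> funs.span B"
    have "finite B"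
      using funs.independent_span_bound[OF finD(1) assms(3)] assms(2) D by blast
    moreover have "funs.independent (insert f B)" using f(2) assms(3) by (rule funs.independent_insertI)
    moreover have "insert f B \<subseteq> funs.span D" using f(1) assms(2) D by blast
    ultimately have "card (insert f B) \<le> card D"
      using funs.independent_span_bound[OF finD(1)] by blast
    moreover have "f \<notin> B" using f(2) funs.span_base by blast
    ultimately show False using \<open>finite B\<close> assms(4) finD(2) by simp
  qed
qed

text \<open>Injectivity is a separate conjunct, since an image set does not record repeated
  functions.\<close>

theorem theorem6p5:
  fixes n :: nat
  assumes "n \<ge> 2"
  shows
    "(\<forall>\<tau> \<in> perms n.
        right_eigenfunction (perms n) (transition_matrix (top_to_random_std n))
          (real (fixed_prefix n \<tau>) / real n) (eigfun n \<tau>))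
     \<and> (\<forall>q\<^sub>2 :: real. 0 \<le> q\<^sub>2 \<and> q\<^sub>2 \<le> 1 \<longrightarrow>
          (\<forall>\<tau> \<in> perms n.
            right_eigenfunction (perms n) (transition_matrix (binomial_top_to_random_std n q\<^sub>2))
              (q\<^sub>2 ^ (n - fixed_prefix n \<tau>)) (eigfun n \<tau>)))
     \<and> inj_on (eigfun n) (perms n)
     \<and> is_basis (eigfun n ` perms n) (functions_on (perms n))"
proof (intro conjI ballI allI impI)
  have n: "n > 0" using assms by simp
  show "right_eigenfunction (perms n) (transition_matrix (top_to_random_std n))
      (real (fixed_prefix n \<tau>) / real n) (eigfun n \<tau>)" if "\<tau> \<in> perms n" for \<tau>
    using n that by (rule right_eigenfunction_top_to_random_std)
  show "right_eigenfunction (perms n) (transition_matrix (binomial_top_to_random_std n q))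
      (q ^ (n - fixed_prefix n \<tau>)) (eigfun n \<tau>)" if "0 \<le> q \<and> q \<le> 1" "\<tau> \<in> perms n" for q \<tau>
    using that by (intro right_eigenfunction_binomial_top_to_random_std) auto
  show inj: "inj_on (eigfun n) (perms n)" using n by (rule inj_on_eigfun)
  have "eigfun n ` perms n \<subseteq> functions_on (perms n)"
    by (auto simp: functions_on_def eigfun_outside)
  then have "funs.span (eigfun n ` perms n) = functions_on (perms n)"
    using independent_eigfun[OF n] card_image[OF inj] by (intro span_eq_functions_on) simp_all
  then show "is_basis (eigfun n ` perms n) (functions_on (perms n))"
    using independent_eigfun[OF n] by (simp add: is_basis_def)
qed

end
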